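(* Let $(\pi_r)_{r\in\mathbb{N}}$ be periods and let $(K_t)_{t\in\mathbb{N}}$ be the multiperiodic process with periods $(\pi_r)$. For $T\in\mathbb{N}$ let $\mathcal{N}_T:=\{K_1,\dots,K_T\}$ be the random set of types. Then for every $T\in\mathbb{N}$ and every $q>0$, $$H(K_1^T)\le\left(e\,\mathbb{E}\operatorname{card}\mathcal{N}_T+2\right)\left((q+2)\log T+q\log\mathbb{E}K_t^{1/q}\right).$$
   Context: $\mathbb{N}=\{1,2,3,\dots\}$; $\log$ is the natural logarithm; $H(K_1^T)=\mathbb{E}[-\log P(K_1^T)]$ is the Shannon entropy of the block $K_1^T=(K_1,\dots,K_T)$. Multiperiodic sequence with periods $\pi_r\in\mathbb{N}$ and seeds $\sigma_r\in\{1,\dots,\pi_r\}$: the sequence $(k_t)_{t\in\mathbb{N}}$ with values in $\mathbb{N}\cup\{\infty\}$ such that for each $r$, the subsequence obtained from $(k_t)$ by deleting all tokens $k_t<r$, denoted $(k^{(r)}_t)_{t\in\mathbb{N}}$, satisfies $k^{(r)}_t=r\iff t\equiv\sigma_r\pmod{\pi_r}$; entries left undefined for all $r$ are set to $\infty$. Equivalently: clocks $\phi_r$ start at $\sigma_r$; for each token, scan $r=1,2,\dots$, decrementing each clock with $\phi_r>1$, until the first $r$ with $\phi_r=1$, output that $r$ and reset $\phi_r=\pi_r$. The multiperiodic process with periods $(\pi_r)$ is the random multiperiodic sequence with these periods and independent random seeds $\Sigma_r$ uniformly distributed on $\{1,\dots,\pi_r\}$; it is stationary, so $\mathbb{E}K_t^{1/q}$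 does not depend on $t$. *)

theory Defs
  imports "HOL-Probability.Probability" "HOL-Library.Extended_Nat"
begin

text \<open>One token of the clock procedure. Clocks are indexed by r \<ge> 1 (index 0 is unused).
  Scan r = 1,2,...: every clock with phi r > 1 passed is decremented; at the first r with
  phi r = 1 output r and reset phi r to the period. If no such r exists, output infinity
  (and all clocks, which are then > 1, are decremented).\<close>
definition mp_step :: "(nat \<Rightarrow> nat) \<Rightarrow> (nat \<Rightarrow> nat) \<Rightarrow> enat \<times> (nat \<Rightarrow> nat)" where
  "mp_step per phi =
     (if \<exists>r\<ge>1. phi r = 1 then
        (let s = (LEAST r. r \<ge> 1 \<and> phi r = 1) in
          (enat s, \<lambda>r. if r < s then phi r - 1 else if r = s then per r else phi r))
      else (\<infinity>, \<lambda>r. phi r - 1))"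

primrec mp_clocks :: "(nat \<Rightarrow> nat) \<Rightarrow> (nat \<Rightarrow> nat) \<Rightarrow> nat \<Rightarrow> (nat \<Rightarrow> nat)" where
  "mp_clocks per sg 0 = sg"
| "mp_clocks per sg (Suc n) = snd (mp_step per (mp_clocks per sg n))"

definition mp_seq :: "(nat \<Rightarrow> nat) \<Rightarrow> (nat \<Rightarrow> nat) \<Rightarrow> nat \<Rightarrow> enat" where
  "mp_seq per sg t = fst (mp_step per (mp_clocks per sg (t - 1)))"

definition mp_measure :: "(nat \<Rightarrow> nat) \<Rightarrow> (nat \<Rightarrow> nat) measure" where
  "mp_measure per = PiM {1..} (\<lambda>r. uniform_count_measure {1..per r})"

definition mp_block :: "(nat \<Rightarrow> nat) \<Rightarrow> nat \<Rightarrow> (nat \<Rightarrow> nat) \<Rightarrow> enat list" where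
  "mp_block per T sg = map (mp_seq per sg) [1..<Suc T]"

definition mp_block_entropy :: "(nat \<Rightarrow> nat) \<Rightarrow> nat \<Rightarrow> ennreal" where
  "mp_block_entropy per T =
     (\<integral>\<^sup>+ sg. ennreal (- ln (measure (mp_measure per)
         {tau \<in> space (mp_measure per). mp_block per T tau = mp_block per T sg}))
       \<partial>mp_measure per)"

definition enat_root :: "real \<Rightarrow> enat \<Rightarrow> ennreal" where
  "enat_root q k = (case k of enat n \<Rightarrow> ennreal (real n powr (1 / q)) | \<infinity> \<Rightarrow> \<infinity>)"

end

theory Submission
  imports Defs
begin

text \<open>A block \<open>K\<^sub>1 \<dots> K\<^sub>T\<close> without \<open>\<infinity>\<close> is determined by the positions and values of the first
  occurrences of its types: once a type has appeared, its clock is a function of the history, and a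
  repeated output is the least type already seen whose clock shows 1. Hence, by Gibbs' inequality,
  the entropy is at most the mean length of a code that describes the \<open>T\<close> positions independently,
  announcing a new type with probability \<open>1 / T\<close> and then its value \<open>r\<close> with probability
  \<open>1 / (r * (r + 1))\<close>. This gives
  \<open>H \<le> (ln T + ln 2) * \<E> N + 2 * \<E> (\<Sum> of ln r over the types r of the block) + (if T = 1 then 0 else 1)\<close>.
  The clocks stay independent and uniform under one step, which acts as a bijection on the first \<open>n\<close>
  clocks for every \<open>n\<close>; so the process is stationary, and the concavity of \<open>ln\<close> bounds the second
  expectation by \<open>q * ln (T * \<E> K powr (1 / q)) * \<E> N\<close>. For \<open>T = 1\<close> the remaining constant \<open>ln 2\<close>
  is absorbed because \<open>K\<^sub>1 = 1\<close> has probability 1 (and then \<open>H = 0\<close>) or at most 1/2.\<close>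

section \<open>Gibbs' inequality and the reference code\<close>

text \<open>Gibbs' inequality from \<open>ln u \<le> u - 1\<close> at the likelihood ratio
  \<open>u = d x / p x\<close>, whose mean under \<open>p\<close> is at most 1. The inclusion of
  supports keeps the default \<open>ln 0 = 0\<close> from making the right side too small.\<close>

lemma nn_integral_ln_pmf_le:
  assumes "set_pmf p \<subseteq> set_pmf d"
  shows "(\<integral>\<^sup>+ x. ennreal (- ln (pmf p x)) \<partial>p) \<le> (\<integral>\<^sup>+ x. ennreal (- ln (pmf d x)) \<partial>p)"
proof -
  \<comment> \<open>Negative terms are moved across so that everything stays in
    \<open>ennreal\<close>; the constant 1 is cancelled at the end.\<close>
  have pw: "ennreal (- ln (pmf p x)) + 1 \<le> ennreal (- ln (pmf d x)) + ennreal (pmf d x / pmf p x)"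
    if "x \<in> set_pmf p" for x
  proof -
    have P: "pmf p x > 0" "pmf d x > 0" using that assms by (auto simp: pmf_positive)
    then have nonneg: "- ln (pmf p x) \<ge> 0" "- ln (pmf d x) \<ge> 0"
      by (simp_all add: pmf_le_1)
    have "ln (pmf d x / pmf p x) \<le> pmf d x / pmf p x - 1"
      using P by (intro ln_le_minus_one) auto
    then have "- ln (pmf p x) + 1 \<le> - ln (pmf d x) + pmf d x / pmf p x"
      using P by (simp add: ln_div)
    then have "ennreal (- ln (pmf p x) + 1) \<le> ennreal (- ln (pmf d x) + pmf d x / pmf p x)"
      by (rule ennreal_leI)
    then show ?thesis
      using nonneg P by (subst (asm) (1 2) ennreal_plus) auto
  qed
  have "(\<integral>\<^sup>+ x. ennreal (pmf d x / pmf p x) \<partial>p)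
      = (\<integral>\<^sup>+ x. ennreal (pmf p x) * ennreal (pmf d x / pmf p x) \<partial>count_space UNIV)"
    by (rule nn_integral_measure_pmf)
  also have "\<dots> \<le> (\<integral>\<^sup>+ x. ennreal (pmf d x) \<partial>count_space UNIV)"
    by (intro nn_integral_mono) (auto simp: ennreal_mult[symmetric])
  also have "\<dots> = 1"
    by (simp add: nn_integral_pmf)
  finally have ratio: "(\<integral>\<^sup>+ x. ennreal (pmf d x / pmf p x) \<partial>p) \<le> 1" .
  have "(\<integral>\<^sup>+ x. ennreal (- ln (pmf p x)) \<partial>p) + 1 = (\<integral>\<^sup>+ x. ennreal (- ln (pmf p x)) + 1 \<partial>p)"
    by (simp add: nn_integral_add)
  also have "\<dots> \<le> (\<integral>\<^sup>+ x. ennreal (- ln (pmf d x)) + ennreal (pmf d x / pmf p x) \<partial>p)"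
    using pw by (intro nn_integral_mono_AE) (simp add: AE_measure_pmf_iff)
  also have "\<dots> \<le> (\<integral>\<^sup>+ x. ennreal (- ln (pmf d x)) \<partial>p) + 1"
    using ratio by (simp add: nn_integral_add)
  finally show ?thesis by (simp add: add.commute[of _ 1])
qed

text \<open>The law of \<open>X\<close> is discrete, and a code that is injective on its atoms
  preserves their masses. The entropy is therefore that of the coded variable, to which Gibbs'
  inequality applies with the reference distribution \<open>d\<close>.\<close>

lemma (in prob_space) entropy_le_code:
  fixes X :: "'a \<Rightarrow> 'b :: countable" and d :: "'c pmf"
  assumes X [measurable]: "X \<in> M \<rightarrow>\<^sub>M count_space UNIV"
    and inj: "inj_on c {x. prob {w \<in> space M. X w = x} > 0}"
    and supp: "\<And>x. prob {w \<in> space M. X w = x} > 0 \<Longrightarrow> pmf d (c x) > 0"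
  shows "(\<integral>\<^sup>+ v. ennreal (- ln (prob {w \<in> space M. X w = X v})) \<partial>M)
    \<le> (\<integral>\<^sup>+ v. ennreal (- ln (pmf d (c (X v)))) \<partial>M)"
proof -
  define D where "D = distr M (count_space UNIV) X"
  interpret D: prob_space D unfolding D_def by (rule prob_space_distr) simp
  have sets_D: "sets D = UNIV" by (simp add: D_def)
  \<comment> \<open>On a countable type almost every point is an atom, which is what makes
    \<open>D\<close> a pmf.\<close>
  have "AE x in D. measure D {x} \<noteq> 0"
    by (subst D.AE_support_countable) (auto simp: sets_D intro!: exI[of _ UNIV])
  then have "D \<in> {M. prob_space M \<and> sets M = UNIV \<and> (AE x in M. measure M {x} \<noteq> 0)}"
    using D.prob_space_axioms sets_D by simp
  then have p: "measure_pmf (Abs_pmf D) = D" by (rule Abs_pmf_inverse)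
  define p where "p = Abs_pmf D"
  have pmf_p: "pmf p x = prob {w \<in> space M. X w = x}" for x
    unfolding pmf.rep_eq p_def p unfolding D_def
    by (subst measure_distr) (auto intro!: arg_cong[of _ _ prob])
  have set_p: "set_pmf p = {x. prob {w \<in> space M. X w = x} > 0}"
    by (auto simp: set_pmf_eq pmf_p measure_nonneg less_le)
  have integral_p: "(\<integral>\<^sup>+ x. f x \<partial>p) = (\<integral>\<^sup>+ v. f (X v) \<partial>M)" for f
    unfolding p_def p unfolding D_def by (subst nn_integral_distr) auto
  have "(\<integral>\<^sup>+ v. ennreal (- ln (prob {w \<in> space M. X w = X v})) \<partial>M) =
      (\<integral>\<^sup>+ x. ennreal (- ln (pmf p x)) \<partial>p)"
    by (simp add: integral_p pmf_p)
  also have "\<dots> = (\<integral>\<^sup>+ x. ennreal (- ln (pmf (map_pmf c p) (c x))) \<partial>p)"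
    using inj by (intro nn_integral_cong_AE) (simp add: AE_measure_pmf_iff pmf_map_inj set_p)
  also have "\<dots> = (\<integral>\<^sup>+ y. ennreal (- ln (pmf (map_pmf c p) y)) \<partial>map_pmf c p)"
    by simp
  also have "\<dots> \<le> (\<integral>\<^sup>+ y. ennreal (- ln (pmf d y)) \<partial>map_pmf c p)"
    using supp by (intro nn_integral_ln_pmf_le) (auto simp: set_p set_pmf_iff less_le)
  also have "\<dots> = (\<integral>\<^sup>+ v. ennreal (- ln (pmf d (c (X v)))) \<partial>M)"
    by (simp add: integral_p)
  finally show ?thesis .
qed

section \<open>The reference code and its length\<close>

text \<open>The value 0 encodes that no new type appears; the positive values have the telescoping weights
  \<open>z / n - z / (n + 1)\<close>, whose code length is about \<open>2 * ln n - ln z\<close>.\<close>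
definition slow_pmf :: "real \<Rightarrow> nat pmf" where
  "slow_pmf z = embed_pmf (\<lambda>n. if n = 0 then 1 - z else z / (real n * (real n + 1)))"

lemma pmf_slow:
  assumes "0 \<le> z" "z \<le> 1"
  shows "pmf (slow_pmf z) n = (if n = 0 then 1 - z else z / (real n * (real n + 1)))"
proof -
  let ?f = "\<lambda>n. if n = 0 then 1 - z else z / (real n * (real n + 1))"
  have nonneg: "?f n \<ge> 0" for n using assms by simp
  have "(\<lambda>n. 1 / real (Suc n)) \<longlonglongrightarrow> 0"
    by real_asymp
  then have "(\<lambda>n. 1 / real (Suc n) - 1 / real (Suc (Suc n))) sums (1 / real (Suc 0) - 0)"
    by (rule telescope_sums')
  then have "(\<lambda>n. z * (1 / real (Suc n) - 1 / real (Suc (Suc n)))) sums (z * 1)"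
    by (intro sums_mult) simp
  moreover have "z * (1 / real (Suc n) - 1 / real (Suc (Suc n))) = ?f (Suc n)" for n
    by (simp add: field_simps)
  ultimately have "(\<lambda>n. ?f (Suc n)) sums (1 - ?f 0)" by simp
  then have "?f sums (1 - ?f 0 + ?f 0)" by (subst (asm) sums_Suc_iff)
  then have "?f sums 1" by simp
  then have "(\<Sum>n. ennreal (?f n)) = 1"
    using nonneg by (subst suminf_ennreal2) (auto simp: sums_iff)
  then have "(\<integral>\<^sup>+ n. ennreal (?f n) \<partial>count_space UNIV) = 1"
    by (simp add: nn_integral_count_space_nat)
  with nonneg show ?thesis
    unfolding slow_pmf_def by (subst pmf_embed_pmf) auto
qed

text \<open>The length of an independent code is the sum over its positions. A position carrying
  \<open>n\<close> costs \<open>ln T + ln n + ln (n + 1)\<close>; the at most \<open>T - 1\<close>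
  silent positions cost at most \<open>1 / (T - 1)\<close> each, hence at most 1 together.\<close>

lemma neg_ln_pmf_slow_code:
  fixes c :: "nat \<Rightarrow> nat"
  defines "d \<equiv> \<lambda>T. Pi_pmf {..<T} 0 (\<lambda>_. slow_pmf (1 / real T))"
  assumes T: "T \<ge> 1" and c0: "c 0 \<noteq> 0" and out: "\<And>i. i \<ge> T \<Longrightarrow> c i = 0"
  shows "pmf (d T) c > 0" (is ?pos)
    and "- ln (pmf (d T) c) \<le>
      (\<Sum>i | i < T \<and> c i \<noteq> 0. ln (real T) + ln 2 + 2 * ln (real (c i))) + (if T = 1 then 0 else 1)"
      (is ?bound)
proof -
  let ?q = "\<lambda>i. pmf (slow_pmf (1 / real T)) (c i)"
  have q: "?q i = (if c i = 0 then 1 - 1 / real T else 1 / real T / (real (c i) * (real (c i) + 1)))" for i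
    using T by (intro pmf_slow) auto
  have q_pos: "?q i > 0" if "i < T" for i
  proof (cases "c i = 0")
    case True
    \<comment> \<open>For \<open>T = 1\<close> silence has probability 0, so it matters that
      position 0 is never silent: a silent position forces \<open>T > 1\<close>.\<close>
    then have "i \<noteq> 0" using c0 by (intro notI) simp
    with that have "real T > 1" by simp
    moreover have "?q i = 1 - 1 / real T" using q[of i] True by simp
    ultimately show ?thesis by simp
  qed (use T in \<open>simp add: q\<close>)
  have d: "pmf (d T) c = (\<Prod>i<T. ?q i)"
    unfolding d_def using out by (subst pmf_Pi) auto
  show ?pos unfolding d using q_pos by (intro prod_pos) auto
  let ?S = "{i. i < T \<and> c i \<noteq> 0}" and ?N = "{i. i < T \<and> c i = 0}"
  have "- ln (pmf (d T) c) = (\<Sum>i<T. - ln (?q i))"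
    unfolding d using q_pos by (subst ln_prod) (fastforce simp: sum_negf)+
  also have "{..<T} = ?S \<union> ?N" by auto
  also have "(\<Sum>i\<in>?S \<union> ?N. - ln (?q i)) = (\<Sum>i\<in>?S. - ln (?q i)) + (\<Sum>i\<in>?N. - ln (?q i))"
    by (intro sum.union_disjoint) auto
  also have "(\<Sum>i\<in>?S. - ln (?q i)) \<le> (\<Sum>i\<in>?S. ln (real T) + ln 2 + 2 * ln (real (c i)))"
  proof (rule sum_mono)
    fix i assume "i \<in> ?S"
    then have c: "real (c i) \<ge> 1" by auto
    have "- ln (?q i) = ln (real T) + ln (real (c i)) + ln (real (c i) + 1)"
      using c T by (simp add: q ln_div ln_mult)
    \<comment> \<open>The estimate \<open>n + 1 \<le> 2 * n\<close> is the origin of the constant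
      \<open>ln 2\<close>.\<close>
    also have "ln (real (c i) + 1) \<le> ln (2 * real (c i))"
      using c by (subst ln_le_cancel_iff) auto
    also have "\<dots> = ln 2 + ln (real (c i))" using c by (simp add: ln_mult)
    finally show "- ln (?q i) \<le> ln (real T) + ln 2 + 2 * ln (real (c i))" by simp
  qed
  also have "(\<Sum>i\<in>?N. - ln (?q i)) \<le> (if T = 1 then 0 else 1)"
  proof (cases "T = 1")
    case True
    then have "?N = {}" using c0 by (auto intro!: gr0I)
    then show ?thesis unfolding \<open>?N = {}\<close> by simp
  next
    case False
    with T have T2: "real T \<ge> 2" by simp
    have "- ln (1 - 1 / real T) = ln (1 + 1 / (real T - 1))"
      using T2 by (simp add: field_simps flip: ln_inverse)
    also have "\<dots> \<le> 1 / (real T - 1)" using T2 by (intro ln_add_one_self_le_self) auto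
    finally have one: "- ln (1 - 1 / real T) \<le> 1 / (real T - 1)" .
    have "?N \<subseteq> {1..<T}" using c0 by (auto simp: Suc_le_eq intro!: gr0I)
    then have "card ?N \<le> T - 1" using card_mono[of "{1..<T}" ?N] by simp
    then have card: "real (card ?N) \<le> real T - 1" using T by linarith
    have "pmf (slow_pmf (1 / real T)) 0 = 1 - 1 / real T"
      using T by (subst pmf_slow) auto
    then have "(\<Sum>i\<in>?N. - ln (?q i)) = real (card ?N) * (- ln (1 - 1 / real T))"
      by simp
    also have "\<dots> \<le> (real T - 1) * (1 / (real T - 1))"
      using one card T2 by (intro mult_mono) auto
    also have "\<dots> = 1" using T2 by simp
    finally show ?thesis using False by simp
  qed
  finally show ?bound by simp
qed

section \<open>Reconstruction from first occurrences\<close>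

definition first_occs :: "'a list \<Rightarrow> nat set" where
  "first_occs xs = {i. i < length xs \<and> (\<forall>j<i. xs ! j \<noteq> xs ! i)}"

lemma finite_first_occs [simp]: "finite (first_occs xs)"
  by (simp add: first_occs_def)

text \<open>Reading the list at these positions is a bijection onto its set of entries.\<close>

lemma card_first_occs: "card (first_occs xs) = card (set xs)"
proof (rule bij_betw_same_card)
  have "inj_on ((!) xs) (first_occs xs)"
    by (rule inj_onI) (metis (mono_tags, lifting) first_occs_def linorder_neqE_nat mem_Collect_eq)
  moreover have "x \<in> (!) xs ` first_occs xs" if "x \<in> set xs" for x
  proof -
    define i where "i = (LEAST i. i < length xs \<and> xs ! i = x)"
    have "\<exists>i. i < length xs \<and> xs ! i = x" using that by (simp add: in_set_conv_nth)
    then have i: "i < length xs \<and> xs ! i = x" unfolding i_def by (rule LeastI_ex)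
    moreover have "xs ! j \<noteq> x" if "j < i" for j
      using not_less_Least[of j "\<lambda>i. i < length xs \<and> xs ! i = x"] that i by (auto simp: i_def)
    ultimately show ?thesis by (auto simp: first_occs_def intro!: image_eqI[of _ _ i])
  qed
  ultimately show "bij_betw ((!) xs) (first_occs xs) (set xs)"
    by (auto simp: bij_betw_def first_occs_def)
qed

text \<open>The value 0 can mark a repetition because every output is at least 1. On an entry
  \<infinity> the value of \<open>the_enat\<close> is unspecified, so the code is decoded only for
  blocks without \<infinity>.\<close>

definition first_code :: "enat list \<Rightarrow> nat \<Rightarrow> nat" where
  "first_code b i = (if i \<in> first_occs b then the_enat (b ! i) else 0)"

section \<open>One step of the clock procedure\<close>

lemma fst_mp_step_eq_enat_iff:
  "fst (mp_step per phi) = enat k \<longleftrightarrow> k \<ge> 1 \<and> phi k = 1 \<and> (\<forall>s. 1 \<le> s \<and> s < k \<longrightarrow> phi s \<noteq> 1)"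
proof (cases "\<exists>r\<ge>1. phi r = 1")
  case True
  define P where "P r \<longleftrightarrow> r \<ge> 1 \<and> phi r = 1" for r
  have "\<exists>r. P r" using True by (auto simp: P_def)
  then have "(LEAST r. P r) = k \<longleftrightarrow> P k \<and> (\<forall>s<k. \<not> P s)"
    by (metis LeastI_ex Least_le not_less_Least linorder_not_less order_antisym_conv)
  moreover have "fst (mp_step per phi) = enat (LEAST r. P r)"
    using True by (auto simp: mp_step_def Let_def P_def)
  ultimately show ?thesis by (auto simp: P_def)
qed (auto simp: mp_step_def)

lemma snd_mp_step:
  "snd (mp_step per phi) r =
     (case fst (mp_step per phi) of
        enat s \<Rightarrow> if r < s then phi r - 1 else if r = s then per r else phi r
      | \<infinity> \<Rightarrow> phi r - 1)"
  by (auto simp: mp_step_def Let_def)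

lemma fst_mp_step_cong:
  assumes "\<And>r. r \<ge> 1 \<Longrightarrow> phi r = psi r"
  shows "fst (mp_step per phi) = fst (mp_step per psi)"
proof -
  have "(\<lambda>r. r \<ge> 1 \<and> phi r = 1) = (\<lambda>r. r \<ge> 1 \<and> psi r = 1)" using assms by auto
  then show ?thesis unfolding mp_step_def Let_def by (auto dest: fun_cong)
qed

text \<open>The new value of clock \<open>r\<close> as a function of clocks 1 to \<open>r\<close>
  alone: a cyclic rotation of \<open>{1..per r}\<close> unless the scan stops earlier. This
  triangular form makes the step invertible on the first \<open>n\<close> clocks.\<close>

definition clock_rot :: "(nat \<Rightarrow> nat) \<Rightarrow> (nat \<Rightarrow> nat) \<Rightarrow> nat \<Rightarrow> nat" where
  "clock_rot per phi r =
     (if \<exists>s\<in>{1..<r}. phi s = 1 then phi r else if phi r = 1 then per r else phi r - 1)"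

lemma snd_mp_step_eq_clock_rot:
  assumes "r \<ge> 1"
  shows "snd (mp_step per phi) r = clock_rot per phi r"
proof (cases "fst (mp_step per phi)")
  case (enat s)
  then have s: "s \<ge> 1" "phi s = 1" "\<And>u. 1 \<le> u \<Longrightarrow> u < s \<Longrightarrow> phi u \<noteq> 1"
    by (auto simp: fst_mp_step_eq_enat_iff)
  consider "r < s" | "r = s" | "r > s" by linarith
  then show ?thesis
  proof cases
    case 1
    then have "\<not> (\<exists>u\<in>{1..<r}. phi u = 1)" "phi r \<noteq> 1" using s assms by auto
    with 1 show ?thesis unfolding snd_mp_step enat clock_rot_def by simp
  next
    case 2
    then have "\<not> (\<exists>u\<in>{1..<r}. phi u = 1)" using s assms by auto
    with 2 s show ?thesis unfolding snd_mp_step enat clock_rot_def by simp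
  next
    case 3
    then have "\<exists>u\<in>{1..<r}. phi u = 1" using s by auto
    with 3 show ?thesis unfolding snd_mp_step enat clock_rot_def by simp
  qed
next
  case infinity
  then have "\<not> (\<exists>r\<ge>1. phi r = 1)" by (auto simp: mp_step_def Let_def split: if_splits)
  then have "\<not> (\<exists>u\<in>{1..<r}. phi u = 1)" "phi r \<noteq> 1" using assms by auto
  then show ?thesis unfolding snd_mp_step infinity clock_rot_def by simp
qed

lemma clock_rot_cong:
  assumes "\<And>s. 1 \<le> s \<Longrightarrow> s \<le> r \<Longrightarrow> phi s = psi s" "r \<ge> 1"
  shows "clock_rot per phi r = clock_rot per psi r"
proof -
  have "(\<exists>s\<in>{1..<r}. phi s = 1) = (\<exists>s\<in>{1..<r}. psi s = 1)" using assms by auto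
  then show ?thesis using assms by (simp add: clock_rot_def)
qed

text \<open>Unlike \<^const>\<open>mp_clocks\<close>, whose value at the unused index 0 changes, this map stays inside the
  space of the product measure.\<close>
definition clock_shift :: "(nat \<Rightarrow> nat) \<Rightarrow> (nat \<Rightarrow> nat) \<Rightarrow> nat \<Rightarrow> nat" where
  "clock_shift per phi = restrict (clock_rot per phi) {1..}"

text \<open>Index 0 is the only place where the two can differ, and neither the outputs nor the
  updates of the other clocks look at it.\<close>

lemma mp_clocks_eq_clock_shift:
  "r \<ge> 1 \<Longrightarrow> mp_clocks per sg n r = (clock_shift per ^^ n) sg r"
proof (induction n arbitrary: r)
  case (Suc n)
  have "mp_clocks per sg (Suc n) r = clock_rot per (mp_clocks per sg n) r"
    using Suc.prems by (simp add: snd_mp_step_eq_clock_rot)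
  also have "\<dots> = clock_rot per ((clock_shift per ^^ n) sg) r"
    using Suc by (intro clock_rot_cong) auto
  finally show ?case
    using Suc.prems by (simp add: clock_shift_def[of per "(clock_shift per ^^ n) sg"])
qed simp

lemma mp_seq_Suc: "mp_seq per sg (Suc i) = fst (mp_step per (mp_clocks per sg i))"
  by (simp add: mp_seq_def)

lemma mp_seq_Suc_clock_shift:
  "mp_seq per sg (Suc i) = fst (mp_step per ((clock_shift per ^^ i) sg))"
  unfolding mp_seq_Suc by (rule fst_mp_step_cong) (simp add: mp_clocks_eq_clock_shift)

lemma mp_seq_ge_1: "mp_seq per sg (Suc i) = enat k \<Longrightarrow> k \<ge> 1"
  by (simp add: mp_seq_Suc fst_mp_step_eq_enat_iff)

section \<open>Recovering a block from its code\<close>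

lemma length_mp_block [simp]: "length (mp_block per T sg) = T"
  by (simp add: mp_block_def)

lemma nth_mp_block: "i < T \<Longrightarrow> mp_block per T sg ! i = mp_seq per sg (Suc i)"
  by (simp add: mp_block_def del: upt_Suc)

text \<open>The output of \<open>r\<close> resets its clock to \<open>per r\<close> whatever the
  seed was; from then on each update depends only on the current clock value and the output.\<close>

lemma mp_clocks_eq_if_seen:
  assumes "\<And>i. i < n \<Longrightarrow> mp_seq per sg (Suc i) = mp_seq per tg (Suc i)"
    and "\<exists>i<n. mp_seq per sg (Suc i) = enat r"
  shows "mp_clocks per sg n r = mp_clocks per tg n r"
  using assms
proof (induction n)
  case (Suc n)
  have eq: "fst (mp_step per (mp_clocks per sg n)) = fst (mp_step per (mp_clocks per tg n))"
    using Suc.prems(1)[of n] by (simp add: mp_seq_Suc)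
  show ?case
  proof (cases "mp_seq per sg (Suc n) = enat r")
    case True
    then show ?thesis using eq by (simp add: snd_mp_step mp_seq_Suc)
  next
    case False
    then have "\<exists>i<n. mp_seq per sg (Suc i) = enat r" using Suc.prems(2) less_Suc_eq by auto
    then have "mp_clocks per sg n r = mp_clocks per tg n r" using Suc by simp
    then show ?thesis using eq by (simp add: snd_mp_step split: enat.split)
  qed
qed simp

text \<open>A repeated output is the least type already seen whose clock shows 1, and the clocks of types
  already seen are a function of the history.\<close>
lemma mp_seq_le_if_repeated:
  assumes "\<And>i. i < n \<Longrightarrow> mp_seq per sg (Suc i) = mp_seq per tg (Suc i)"
    and "\<exists>i<n. mp_seq per sg (Suc i) = enat r"
    and r: "mp_seq per sg (Suc n) = enat r" and s: "mp_seq per tg (Suc n) = enat s"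
  shows "s \<le> r"
proof -
  have "mp_clocks per tg n r = 1" "r \<ge> 1"
    using mp_clocks_eq_if_seen[OF assms(1,2)] r by (auto simp: mp_seq_Suc fst_mp_step_eq_enat_iff)
  then show ?thesis
    using s by (auto simp: mp_seq_Suc fst_mp_step_eq_enat_iff simp flip: linorder_not_less)
qed

lemma first_code_mp_block:
  assumes "i < T"
  shows "first_code (mp_block per T sg) i =
    (if \<exists>j<i. mp_seq per sg (Suc j) = mp_seq per sg (Suc i) then 0
     else the_enat (mp_seq per sg (Suc i)))"
  using assms by (auto simp: first_code_def first_occs_def nth_mp_block)

text \<open>Strong induction on time. The code tells whether an output is new; a new one is read off
  directly, a repeated one is forced by the common past.\<close>

lemma mp_block_eqI_first_code:
  assumes fin: "\<And>i. i < T \<Longrightarrow> mp_seq per sg (Suc i) \<noteq> \<infinity>" "\<And>i. i < T \<Longrightarrow> mp_seq per tg (Suc i) \<noteq> \<infinity>"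
    and code: "first_code (mp_block per T sg) = first_code (mp_block per T tg)"
  shows "mp_block per T sg = mp_block per T tg"
proof -
  have "mp_seq per sg (Suc i) = mp_seq per tg (Suc i)" if "i < T" for i
    using that
  proof (induction i rule: less_induct)
    case (less i)
    then have IH: "mp_seq per sg (Suc j) = mp_seq per tg (Suc j)" if "j < i" for j
      using that by auto
    obtain r s where r: "mp_seq per sg (Suc i) = enat r" and s: "mp_seq per tg (Suc i) = enat s"
      using fin less.prems by (metis enat.exhaust)
    have pos: "r \<ge> 1" "s \<ge> 1" using r s mp_seq_ge_1 by blast+
    have c: "(if \<exists>j<i. mp_seq per sg (Suc j) = enat r then 0 else r) =
             (if \<exists>j<i. mp_seq per tg (Suc j) = enat s then 0 else s)"
      using fun_cong[OF code, of i] less.prems by (simp add: first_code_mp_block r s cong: if_cong)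
    show ?case
    proof (cases "\<exists>j<i. mp_seq per sg (Suc j) = enat r")
      case True
      then have True': "\<exists>j<i. mp_seq per tg (Suc j) = enat s" using c pos by (auto split: if_splits)
      \<comment> \<open>The comparison is used twice, with the roles of the two seeds
        exchanged.\<close>
      have "s \<le> r" by (rule mp_seq_le_if_repeated[OF IH True r s])
      moreover have "r \<le> s" by (rule mp_seq_le_if_repeated[OF IH[symmetric] True' s r])
      ultimately show ?thesis using r s by simp
    next
      case False
      then show ?thesis using c pos r s by (auto split: if_splits)
    qed
  qed
  then show ?thesis by (intro nth_equalityI) (auto simp: nth_mp_block)
qed

section \<open>Stationarity\<close>

locale multiperiodic =
  fixes per :: "nat \<Rightarrow> nat"
  assumes per_ge_1: "r \<ge> 1 \<Longrightarrow> per r \<ge> 1"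
begin

abbreviation "M \<equiv> mp_measure per"

text \<open>The finite state space of the first \<open>n\<close> clocks; its elements are the bases
  of cylinder sets.\<close>

abbreviation "cylinders n \<equiv> PiE {1..n} (\<lambda>r. {1..per r})"

lemma space_M: "space M = PiE {1..} (\<lambda>r. {1..per r})"
  by (simp add: mp_measure_def space_PiM space_uniform_count_measure)

lemma prob_space_seed: "r \<ge> 1 \<Longrightarrow> prob_space (uniform_count_measure {1..per r})"
  using per_ge_1[of r] by (intro prob_space_uniform_count_measure) auto

sublocale prob_space M
  unfolding mp_measure_def by (intro prob_space_PiM prob_space_seed) auto

lemma measurable_seed [measurable]: "(\<lambda>sg. sg r) \<in> M \<rightarrow>\<^sub>M count_space UNIV"
proof (cases "r \<ge> 1")
  case True
  then have "(\<lambda>sg. sg r) \<in> M \<rightarrow>\<^sub>M uniform_count_measure {1..per r}"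
    unfolding mp_measure_def by (intro measurable_component_singleton) auto
  moreover have "(\<lambda>x. x) \<in> uniform_count_measure {1..per r} \<rightarrow>\<^sub>M count_space UNIV"
    by (simp add: measurable_def sets_uniform_count_measure space_uniform_count_measure)
  ultimately show ?thesis by (rule measurable_compose)
next
  case False
  \<comment> \<open>Index 0 lies outside the product, so this coordinate is constant.\<close>
  then have "sg r = undefined" if "sg \<in> space M" for sg
    using that by (auto simp: space_M PiE_iff extensional_def)
  then show ?thesis by (subst measurable_cong[where g = "\<lambda>_. undefined"]) auto
qed

section \<open>Invariance of the seed measure under one step\<close>

lemma clock_rot_in_range:
  assumes "r \<ge> 1" "phi r \<in> {1..per r}"
  shows "clock_rot per phi r \<in> {1..per r}"
  using assms by (auto simp: clock_rot_def)

lemma measurable_clock_shift [measurable]: "clock_shift per \<in> M \<rightarrow>\<^sub>M M"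
proof -
  have "(\<lambda>phi. clock_rot per phi r) \<in> M \<rightarrow>\<^sub>M uniform_count_measure {1..per r}" if r: "r \<ge> 1" for r
  proof -
    have "(\<lambda>phi. clock_rot per phi r) \<in> M \<rightarrow>\<^sub>M count_space UNIV"
      unfolding clock_rot_def
    proof (rule measurable_If)
      show "(\<lambda>phi. if phi r = 1 then per r else phi r - 1) \<in> M \<rightarrow>\<^sub>M count_space UNIV"
        by (rule measurable_compose[OF measurable_seed[of r], of "\<lambda>x. if x = 1 then per r else x - 1"]) simp
    qed measurable
    then have "(\<lambda>phi. clock_rot per phi r) \<in> M \<rightarrow>\<^sub>M count_space {1..per r}"
      using r clock_rot_in_range
      by (auto simp: measurable_count_space_eq_countable measurable_count_space_eq2_countable space_M PiE_iff)
    then show ?thesis by (simp add: measurable_cong_sets[OF refl sets_uniform_count_measure_count_space])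
  qed
  then show ?thesis
    unfolding clock_shift_def mp_measure_def[of per] by (intro measurable_restrict) (auto simp: mp_measure_def)
qed

text \<open>The old clocks are recovered in increasing order: once those below \<open>r\<close>
  agree, both sides take the same branch at \<open>r\<close>, which is the identity or a cyclic
  rotation.\<close>

lemma clock_rot_inj:
  assumes "\<And>r. r \<in> {1..n} \<Longrightarrow> phi r \<in> {1..per r}" "\<And>r. r \<in> {1..n} \<Longrightarrow> psi r \<in> {1..per r}"
    and eq: "\<And>r. r \<in> {1..n} \<Longrightarrow> clock_rot per phi r = clock_rot per psi r"
    and "r \<in> {1..n}"
  shows "phi r = psi r"
  using assms(4)
proof (induction r rule: less_induct)
  case (less r)
  then have "(\<exists>s\<in>{1..<r}. phi s = 1) = (\<exists>s\<in>{1..<r}. psi s = 1)" by auto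
  then show ?case
    using eq[OF less.prems] assms(1,2)[OF less.prems] by (auto simp: clock_rot_def split: if_splits)
qed

lemma bij_betw_cylinders:
  "bij_betw (\<lambda>c. restrict (clock_rot per c) {1..n}) (cylinders n) (cylinders n)"
proof -
  let ?f = "\<lambda>c. restrict (clock_rot per c) {1..n}"
  have inj: "inj_on ?f (cylinders n)"
  proof (rule inj_onI)
    fix c d assume c: "c \<in> cylinders n" and d: "d \<in> cylinders n" and eq: "?f c = ?f d"
    have "c r = d r" if "r \<in> {1..n}" for r
    proof (rule clock_rot_inj[OF _ _ _ that])
      show "clock_rot per c r = clock_rot per d r" if "r \<in> {1..n}" for r
        using fun_cong[OF eq, of r] that by simp
    qed (use c d in \<open>auto simp: PiE_iff\<close>)
    with c d show "c = d" by (rule PiE_ext)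
  qed
  have "?f ` cylinders n \<subseteq> cylinders n"
    using clock_rot_in_range by (fastforce simp: PiE_iff)
  then have "?f ` cylinders n = cylinders n"
    using inj by (intro endo_inj_surj finite_PiE) auto
  with inj show ?thesis by (simp add: bij_betw_def)
qed

text \<open>All states of the first \<open>n\<close> clocks are equally likely, so only the
  cardinality of \<open>B\<close> matters and invariance becomes a matter of counting.\<close>

lemma emeasure_restrict:
  assumes "B \<subseteq> cylinders n"
  shows "emeasure M {sg \<in> space M. restrict sg {1..n} \<in> B} =
    of_nat (card B) * (\<Prod>r\<in>{1..n}. ennreal (1 / per r))"
proof -
  let ?A = "\<lambda>c. {sg \<in> space M. \<forall>r\<in>{1..n}. sg r = c r}"
  have finB: "finite B" by (rule finite_subset[OF assms]) (auto intro!: finite_PiE)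
  have emb: "?A c = prod_emb {1..} (\<lambda>r. uniform_count_measure {1..per r}) {1..n} (PiE {1..n} (\<lambda>r. {c r}))"
    for c
    by (auto simp: prod_emb_def space_M space_uniform_count_measure PiE_iff extensional_def)
  have A: "emeasure M (?A c) = (\<Prod>r\<in>{1..n}. ennreal (1 / per r))" if "c \<in> B" for c
  proof -
    have c: "c r \<in> {1..per r}" if "r \<in> {1..n}" for r
      using \<open>c \<in> B\<close> assms that by (auto simp: PiE_iff)
    have "emeasure M (?A c) = (\<Prod>r\<in>{1..n}. emeasure (uniform_count_measure {1..per r}) {c r})"
      using c
      by (unfold emb, unfold mp_measure_def, intro emeasure_PiM_emb prob_space_seed) (auto simp: sets_uniform_count_measure)
    also have "\<dots> = (\<Prod>r\<in>{1..n}. ennreal (1 / per r))"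
      using c by (intro prod.cong) (auto simp: emeasure_uniform_count_measure)
    finally show ?thesis .
  qed
  have sets: "?A c \<in> sets M" for c
    by measurable
  have "{sg \<in> space M. restrict sg {1..n} \<in> B} = (\<Union>c\<in>B. ?A c)"
  proof safe
    fix sg c assume "sg \<in> space M" "c \<in> B" "\<forall>r\<in>{1..n}. sg r = c r"
    moreover from this have "restrict sg {1..n} = c"
      using assms by (intro ext) (auto simp: PiE_iff extensional_def restrict_def)
    ultimately show "restrict sg {1..n} \<in> B" by simp
  next
    fix sg assume "sg \<in> space M" "restrict sg {1..n} \<in> B"
    then show "sg \<in> (\<Union>c\<in>B. ?A c)" by (intro UN_I[of "restrict sg {1..n}"]) auto
  qed
  also have "emeasure M \<dots> = (\<Sum>c\<in>B. emeasure M (?A c))"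
  proof (rule sum_emeasure[symmetric])
    show "disjoint_family_on ?A B"
      unfolding disjoint_family_on_def
    proof (intro ballI impI)
      fix c d assume "c \<in> B" "d \<in> B" "c \<noteq> d"
      with assms have "c \<in> cylinders n" "d \<in> cylinders n" by auto
      then have "\<exists>r\<in>{1..n}. c r \<noteq> d r" using PiE_ext \<open>c \<noteq> d\<close> by blast
      then show "?A c \<inter> ?A d = {}" by force
    qed
  qed (use sets finB in auto)
  finally show ?thesis using A by simp
qed

text \<open>It suffices to compare both measures on finite-dimensional product sets. Such a set is
  described by states of the first \<open>n\<close> clocks, and its preimage by equally many,
  because the step permutes these states.\<close>

lemma distr_clock_shift: "distr M M (clock_shift per) = M"
proof -
  let ?N = "\<lambda>r. uniform_count_measure {1..per r}"
  have "M = distr M M (clock_shift per)"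
  proof (rule measure_eqI_PiM_infinite)
    show "sets M = sets (PiM {1..} ?N)" "sets (distr M M (clock_shift per)) = sets (PiM {1..} ?N)"
      by (simp_all add: mp_measure_def)
    show "finite_measure M" by unfold_locales
    fix A :: "nat \<Rightarrow> nat set" and J :: "nat set"
    assume J: "finite J" "J \<subseteq> {1..}" and A: "\<And>i. i \<in> J \<Longrightarrow> A i \<in> sets (?N i)"
    \<comment> \<open>The clocks in \<open>J\<close> alone do not determine their own updates,
      whereas those in \<open>{1..n}\<close> do.\<close>
    then obtain n where n: "J \<subseteq> {1..n}"
      by (metis Max_ge atLeastAtMost_iff atLeast_iff subset_eq)
    define X where "X = prod_emb {1..} ?N J (PiE J A)"
    let ?f = "\<lambda>c. restrict (clock_rot per c) {1..n}"
    define B where "B = {c \<in> cylinders n. \<forall>r\<in>J. c r \<in> A r}"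
    define B' where "B' = {c \<in> cylinders n. ?f c \<in> B}"
    have X: "X \<in> sets M"
      using J A unfolding X_def mp_measure_def by (intro sets_PiM_I) auto
    have X_eq: "X = {sg \<in> space M. restrict sg {1..n} \<in> B}"
    proof -
      have "restrict sg {1..n} r = sg r" if "r \<in> J" for sg :: "nat \<Rightarrow> nat" and r
        using n that by auto
      moreover have "restrict sg {1..n} \<in> cylinders n" if "sg \<in> space M" for sg
        using that by (auto simp: space_M PiE_iff)
      moreover have "sg \<in> X \<longleftrightarrow> sg \<in> space M \<and> (\<forall>r\<in>J. sg r \<in> A r)" for sg
        by (auto simp: X_def prod_emb_def space_M space_uniform_count_measure PiE_iff extensional_def)
      ultimately show ?thesis by (auto simp: B_def)
    qed
    have "clock_shift per -` X \<inter> space M = {sg \<in> space M. restrict sg {1..n} \<in> B'}"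
    proof -
      have "?f (restrict sg {1..n}) = restrict (clock_shift per sg) {1..n}" for sg
        unfolding clock_shift_def
        by (rule ext) (auto simp: restrict_def intro!: clock_rot_cong)
      moreover have "restrict sg {1..n} \<in> cylinders n" "clock_shift per sg \<in> space M"
        if "sg \<in> space M" for sg
        using that measurable_space[OF measurable_clock_shift that] by (auto simp: space_M PiE_iff)
      ultimately show ?thesis by (auto simp: X_eq B'_def)
    qed
    moreover have "card B' = card B"
    proof (rule bij_betw_same_card[of ?f])
      have "?f ` B' = B"
      proof
        show "B \<subseteq> ?f ` B'"
        proof
          fix c assume "c \<in> B"
          then have "c \<in> ?f ` cylinders n"
            using bij_betw_cylinders[of n] by (simp add: bij_betw_def B_def)
          with \<open>c \<in> B\<close> show "c \<in> ?f ` B'" by (auto simp: B'_def)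
        qed
      qed (auto simp: B'_def)
      moreover have "inj_on ?f B'"
        using bij_betw_cylinders[of n] unfolding B'_def bij_betw_def
        by (blast intro: inj_on_subset)
      ultimately show "bij_betw ?f B' B" by (simp add: bij_betw_def)
    qed
    ultimately have "emeasure (distr M M (clock_shift per)) X =
      emeasure M {sg \<in> space M. restrict sg {1..n} \<in> B'}" "card B' = card B"
      using X by (simp_all only: emeasure_distr[OF measurable_clock_shift])
    moreover have "B \<subseteq> cylinders n" "B' \<subseteq> cylinders n" by (auto simp: B_def B'_def)
    ultimately have "emeasure M X = emeasure (distr M M (clock_shift per)) X"
      by (simp only: X_eq emeasure_restrict)
    then show "emeasure M (prod_emb {1..} ?N J (PiE J A)) =
      emeasure (distr M M (clock_shift per)) (prod_emb {1..} ?N J (PiE J A))"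
      by (simp only: X_def)
  qed
  then show ?thesis ..
qed

section \<open>The output process\<close>

lemma measurable_clock_shift_funpow [measurable]: "(clock_shift per ^^ n) \<in> M \<rightarrow>\<^sub>M M"
  by (induction n) (auto intro: measurable_comp)

lemma distr_clock_shift_funpow: "distr M M (clock_shift per ^^ n) = M"
proof (induction n)
  case (Suc n)
  have "distr M M (clock_shift per ^^ Suc n) = distr (distr M M (clock_shift per ^^ n)) M (clock_shift per)"
    by (subst distr_distr) (auto simp: comp_def)
  then show ?case by (simp add: Suc.IH distr_clock_shift del: funpow.simps)
qed (simp add: id_def)

lemma measurable_output [measurable]: "(\<lambda>sg. fst (mp_step per sg)) \<in> M \<rightarrow>\<^sub>M count_space UNIV"
proof -
  have "(\<lambda>sg. fst (mp_step per sg)) =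
    (\<lambda>sg. if \<exists>r. r \<ge> 1 \<and> sg r = 1 then enat (LEAST r. r \<ge> 1 \<and> sg r = 1) else \<infinity>)"
    by (auto simp: mp_step_def Let_def fun_eq_iff)
  moreover have "(\<lambda>sg. if \<exists>r. r \<ge> 1 \<and> sg r = 1 then enat (LEAST r. r \<ge> 1 \<and> sg r = 1) else \<infinity>)
    \<in> M \<rightarrow>\<^sub>M count_space UNIV"
    by measurable
  ultimately show ?thesis by simp
qed

lemma measurable_mp_seq [measurable]: "(\<lambda>sg. mp_seq per sg (Suc i)) \<in> M \<rightarrow>\<^sub>M count_space UNIV"
  unfolding mp_seq_Suc_clock_shift by (rule measurable_compose[OF measurable_clock_shift_funpow]) simp

lemma stationary:
  "(\<integral>\<^sup>+ sg. f (mp_seq per sg (Suc i)) \<partial>M) = (\<integral>\<^sup>+ sg. f (fst (mp_step per sg)) \<partial>M)"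
proof -
  have "(\<integral>\<^sup>+ sg. f (fst (mp_step per sg)) \<partial>distr M M (clock_shift per ^^ i)) =
    (\<integral>\<^sup>+ sg. f (mp_seq per sg (Suc i)) \<partial>M)"
    unfolding mp_seq_Suc_clock_shift by (intro nn_integral_distr) (auto intro: measurable_compose[OF measurable_output])
  then show ?thesis by (simp add: distr_clock_shift_funpow)
qed

lemma measurable_mp_block [measurable]: "mp_block per T \<in> M \<rightarrow>\<^sub>M count_space UNIV"
proof -
  have "(\<lambda>sg. map (\<lambda>i. mp_seq per sg (Suc i)) [0..<n]) \<in> M \<rightarrow>\<^sub>M count_space UNIV" for n
  proof (induction n)
    case (Suc n)
    have "(\<lambda>sg. (\<lambda>(x, y). x @ [y]) (map (\<lambda>i. mp_seq per sg (Suc i)) [0..<n], mp_seq per sg (Suc n)))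
       \<in> M \<rightarrow>\<^sub>M count_space UNIV"
      using Suc by measurable
    then show ?case by simp
  qed simp
  then have "(\<lambda>sg. map (mp_seq per sg) (map Suc [0..<T])) \<in> M \<rightarrow>\<^sub>M count_space UNIV"
    by (simp add: comp_def)
  then show ?thesis by (simp add: mp_block_def[abs_def] map_Suc_upt del: upt_Suc)
qed

text \<open>The scan begins with clock 1, so the first output is 1 exactly when that clock starts at
  1.\<close>

lemma prob_first_output_eq_1: "prob {sg \<in> space M. mp_seq per sg 1 = 1} = 1 / per 1"
proof -
  have "mp_seq per sg 1 = 1 \<longleftrightarrow> sg 1 = 1" for sg
    using fst_mp_step_eq_enat_iff[of per sg 1] by (simp add: mp_seq_def one_enat_def)
  then have "{sg \<in> space M. mp_seq per sg 1 = 1} =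
    {sg \<in> space M. restrict sg {1..1} \<in> {restrict (\<lambda>_. 1) {1..1}}}"
    by (auto simp: fun_eq_iff restrict_def)
  moreover have "emeasure M \<dots> = ennreal (1 / per 1)"
    using per_ge_1[of 1] by (subst emeasure_restrict) auto
  ultimately show ?thesis by (simp add: measure_def)
qed

end

section \<open>The entropy bound\<close>

definition first_log_sum :: "enat list \<Rightarrow> real" where
  "first_log_sum b = (\<Sum>i\<in>first_occs b. ln (real (the_enat (b ! i))))"

lemma first_log_sum_nonneg: "first_log_sum b \<ge> 0"
proof -
  \<comment> \<open>The default \<open>ln 0 = 0\<close> covers \<open>n = 0\<close>, so blocks
    containing \<infinity> need no separate treatment.\<close>
  have "ln (real n) \<ge> 0" for n :: nat by (cases n) auto
  then show ?thesis unfolding first_log_sum_def by (intro sum_nonneg) auto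
qed

lemma set_mp_block: "set (mp_block per T sg) = mp_seq per sg ` {1..T}"
  by (auto simp: mp_block_def simp del: upt_Suc)

lemma finite_block:
  assumes "\<forall>i<T. mp_seq per sg (Suc i) \<noteq> \<infinity>" "i < T"
  obtains k where "mp_block per T sg ! i = enat k" "k \<ge> 1"
  using assms by (metis enat.exhaust mp_seq_ge_1 nth_mp_block)

lemma first_code_eq_0_iff:
  assumes "\<forall>i<T. mp_seq per sg (Suc i) \<noteq> \<infinity>"
  shows "first_code (mp_block per T sg) i = 0 \<longleftrightarrow> i \<notin> first_occs (mp_block per T sg)"
proof (cases "i \<in> first_occs (mp_block per T sg)")
  case True
  then have "i < T" by (simp add: first_occs_def)
  with assms obtain k where "mp_block per T sg ! i = enat k" "k \<ge> 1" by (rule finite_block)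
  then show ?thesis using True by (simp add: first_code_def)
qed (simp add: first_code_def)

context multiperiodic
begin

definition finite_until :: "nat \<Rightarrow> (nat \<Rightarrow> nat) \<Rightarrow> bool" where
  "finite_until T sg \<longleftrightarrow> (\<forall>i<T. mp_seq per sg (Suc i) \<noteq> \<infinity>)"

definition mean_card :: "nat \<Rightarrow> ennreal" where
  "mean_card T = (\<integral>\<^sup>+ sg. of_nat (card (mp_seq per sg ` {1..T})) \<partial>M)"

definition mean_first_log :: "nat \<Rightarrow> ennreal" where
  "mean_first_log T = (\<integral>\<^sup>+ sg. ennreal (first_log_sum (mp_block per T sg)) \<partial>M)"

lemma measurable_card_block [measurable]:
  "(\<lambda>sg. of_nat (card (set (mp_block per T sg))) :: ennreal) \<in> borel_measurable M"
  by (rule measurable_compose[OF measurable_mp_block]) simp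

lemma measurable_first_log_sum [measurable]:
  "(\<lambda>sg. first_log_sum (mp_block per T sg)) \<in> borel_measurable M"
  by (rule measurable_compose[OF measurable_mp_block]) simp

text \<open>The code bound with \<open>first_code\<close> as code and the independent
  \<open>slow_pmf\<close> code as reference, averaged over the seeds.\<close>

lemma entropy_le_mean_first_log:
  assumes fin: "AE sg in M. finite_until T sg" and T: "T \<ge> 1"
  shows "mp_block_entropy per T \<le>
    ennreal (ln (real T) + ln 2) * mean_card T + 2 * mean_first_log T + (if T = 1 then 0 else 1)"
proof -
  let ?d = "Pi_pmf {..<T} 0 (\<lambda>_. slow_pmf (1 / real T))"
  let ?b = "mp_block per T"
  \<comment> \<open>A block of positive probability must arise from a seed in the set of full
    measure, so the code is injective on all blocks that matter.\<close>
  have realized: "\<exists>sg. finite_until T sg \<and> x = ?b sg" if pos: "prob {w \<in> space M. ?b w = x} > 0" for x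
  proof (rule ccontr)
    assume "\<not> ?thesis"
    then have "AE w in M. \<not> ?b w = x" using fin by (auto elim!: eventually_mono)
    then have "prob {w \<in> space M. ?b w = x} = 0"
      by (intro prob_eq_0[THEN iffD2]) (auto simp: prob_eq_0)
    with pos show False by simp
  qed
  have code: "pmf ?d (first_code (?b sg)) > 0"
    "- ln (pmf ?d (first_code (?b sg))) \<le>
      (ln (real T) + ln 2) * real (card (mp_seq per sg ` {1..T})) + 2 * first_log_sum (?b sg) + (if T = 1 then 0 else 1)"
    if sg: "finite_until T sg" for sg
  proof -
    let ?c = "first_code (?b sg)"
    have nz: "?c i \<noteq> 0 \<longleftrightarrow> i \<in> first_occs (?b sg)" for i
      using sg first_code_eq_0_iff by (auto simp: finite_until_def)
    \<comment> \<open>The first token of a block is always a new type.\<close>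
    have c0: "?c 0 \<noteq> 0" using T unfolding nz by (simp add: first_occs_def)
    have c: "?c i = 0" if "i \<ge> T" for i
      using that by (simp add: first_code_def first_occs_def)
    show "pmf ?d ?c > 0" by (rule neg_ln_pmf_slow_code(1)[of T ?c, OF T c0 c])
    have "{i. i < T \<and> ?c i \<noteq> 0} = first_occs (?b sg)" using nz by (auto simp: first_occs_def)
    then have "(\<Sum>i | i < T \<and> ?c i \<noteq> 0. ln (real T) + ln 2 + 2 * ln (real (?c i))) =
        (\<Sum>i\<in>first_occs (?b sg). ln (real T) + ln 2 + 2 * ln (real (the_enat (?b sg ! i))))"
      by (intro sum.cong) (auto simp: first_code_def)
    also have "\<dots> = (ln (real T) + ln 2) * real (card (mp_seq per sg ` {1..T})) + 2 * first_log_sum (?b sg)"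
      by (simp add: sum.distrib first_log_sum_def card_first_occs set_mp_block sum_distrib_left algebra_simps)
    finally show "- ln (pmf ?d ?c) \<le> (ln (real T) + ln 2) * real (card (mp_seq per sg ` {1..T})) + 2 * first_log_sum (?b sg) + (if T = 1 then 0 else 1)"
      using neg_ln_pmf_slow_code(2)[of T ?c, OF T c0 c] by simp
  qed
  have "mp_block_entropy per T \<le> (\<integral>\<^sup>+ sg. ennreal (- ln (pmf ?d (first_code (?b sg)))) \<partial>M)"
    unfolding mp_block_entropy_def
  proof (rule entropy_le_code)
    show "inj_on first_code {x. prob {w \<in> space M. ?b w = x} > 0}"
    proof (rule inj_onI; clarsimp)
      fix x y assume "prob {w \<in> space M. ?b w = x} > 0" "prob {w \<in> space M. ?b w = y} > 0"
        and eq: "first_code x = first_code y"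
      then obtain sg tg where "finite_until T sg" "x = ?b sg" "finite_until T tg" "y = ?b tg"
        using realized by blast
      with eq show "x = y" by (auto simp: finite_until_def intro!: mp_block_eqI_first_code)
    qed
    show "pmf ?d (first_code x) > 0" if "prob {w \<in> space M. ?b w = x} > 0" for x
      using realized[OF that] code(1) by auto
  qed measurable
  also have "\<dots> \<le> (\<integral>\<^sup>+ sg. ennreal (ln (real T) + ln 2) * of_nat (card (set (?b sg))) +
      2 * ennreal (first_log_sum (?b sg)) + (if T = 1 then 0 else 1) \<partial>M)"
  proof (rule nn_integral_mono_AE, use fin in eventually_elim)
    case (elim sg)
    have "ennreal (- ln (pmf ?d (first_code (?b sg)))) \<le>
      ennreal ((ln (real T) + ln 2) * real (card (mp_seq per sg ` {1..T})) + 2 * first_log_sum (?b sg) + (if T = 1 then 0 else 1))"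
      using code(2)[OF elim] by (rule ennreal_leI)
    also have "\<dots> = ennreal (ln (real T) + ln 2) * of_nat (card (set (?b sg))) +
      2 * ennreal (first_log_sum (?b sg)) + (if T = 1 then 0 else 1)"
      using T first_log_sum_nonneg[of "?b sg"]
      by (simp add: set_mp_block ennreal_mult ennreal_of_nat_eq_real_of_nat)
    finally show ?case .
  qed
  also have "\<dots> = ennreal (ln (real T) + ln 2) * mean_card T + 2 * mean_first_log T + (if T = 1 then 0 else 1)"
    unfolding mean_card_def mean_first_log_def set_mp_block[symmetric]
    by (simp add: nn_integral_add nn_integral_cmult emeasure_space_1)
  finally show ?thesis .
qed

section \<open>Bounds for the means\<close>

lemma mean_card_bounds:
  assumes "T \<ge> 1"
  shows "1 \<le> mean_card T" "mean_card T \<le> of_nat T"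
proof -
  have "card (mp_seq per sg ` {1..T}) \<le> T" for sg
    using card_image_le[of "{1..T}" "mp_seq per sg"] by simp
  then have "mean_card T \<le> (\<integral>\<^sup>+ sg. of_nat T \<partial>M)"
    unfolding mean_card_def by (intro nn_integral_mono) simp
  then show "mean_card T \<le> of_nat T" by (simp add: emeasure_space_1)
  have "1 \<le> card (mp_seq per sg ` {1..T})" for sg
    using assms by (simp add: Suc_le_eq card_gt_0_iff)
  then have "(\<integral>\<^sup>+ sg. of_nat 1 \<partial>M) \<le> mean_card T"
    unfolding mean_card_def by (intro nn_integral_mono of_nat_mono) simp
  then show "1 \<le> mean_card T" by (simp add: emeasure_space_1)
qed

lemma mean_card_1: "mean_card 1 = 1"
  by (simp add: mean_card_def emeasure_space_1)

text \<open>A finite mean forces almost sure finiteness, \<open>enat_root\<close> being \<infinity>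
  at \<infinity>, and stationarity carries this to every time.\<close>

lemma AE_finite_until:
  assumes "(\<integral>\<^sup>+ sg. enat_root q (fst (mp_step per sg)) \<partial>M) \<noteq> \<top>"
  shows "AE sg in M. finite_until T sg"
proof -
  have "AE sg in M. mp_seq per sg (Suc i) \<noteq> \<infinity>" for i
  proof -
    have "(\<integral>\<^sup>+ sg. enat_root q (mp_seq per sg (Suc i)) \<partial>M) \<noteq> \<infinity>"
      using assms by (simp add: stationary infinity_ennreal_def)
    then have "AE sg in M. enat_root q (mp_seq per sg (Suc i)) \<noteq> \<infinity>"
      by (rule nn_integral_PInf_AE[rotated]) (rule measurable_compose[OF measurable_mp_seq], simp)
    then show ?thesis by (auto elim!: eventually_mono simp: enat_root_def infinity_ennreal_def split: enat.splits)
  qed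
  then show ?thesis by (simp add: finite_until_def AE_all_countable)
qed

text \<open>Outputs are at least 1. This makes the logarithm of the mean nonnegative, so that
  \<open>ennreal\<close> does not truncate the final bound.\<close>

lemma mean_root_ge_1:
  assumes "q > 0"
  shows "1 \<le> (\<integral>\<^sup>+ sg. enat_root q (fst (mp_step per sg)) \<partial>M)"
proof -
  have "1 \<le> enat_root q (fst (mp_step per sg))" for sg
  proof (cases "fst (mp_step per sg)")
    case (enat k)
    then have "real k \<ge> 1" by (simp add: fst_mp_step_eq_enat_iff)
    then have "real k powr (1 / q) \<ge> 1" using assms by (intro ge_one_powr_ge_zero) auto
    then show ?thesis using enat by (simp add: enat_root_def)
  qed (simp add: enat_root_def)
  then have "(\<integral>\<^sup>+ sg. 1 \<partial>M) \<le> (\<integral>\<^sup>+ sg. enat_root q (fst (mp_step per sg)) \<partial>M)"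
    by (intro nn_integral_mono)
  then show ?thesis by (simp add: emeasure_space_1)
qed

text \<open>The tangent line to \<open>ln\<close> at \<open>A = T * m\<close> is used: the slope term sums to at most \<open>q\<close> by
  stationarity, which the term \<open>- q\<close> of the first occurrence at time 1 absorbs.\<close>
lemma mean_first_log_le:
  assumes q: "q > 0" and T: "T \<ge> 1" and m: "m \<ge> 1"
    and root: "(\<integral>\<^sup>+ sg. enat_root q (fst (mp_step per sg)) \<partial>M) = ennreal m"
  shows "mean_first_log T \<le> ennreal (q * ln (real T * m)) * mean_card T"
proof -
  define A where "A = real T * m"
  have A: "A \<ge> 1" unfolding A_def using T m mult_mono[of 1 "real T" 1 m] by simp
  have pw: "ennreal (first_log_sum (mp_block per T sg)) + ennreal q \<le>
      ennreal (q * ln A) * of_nat (card (set (mp_block per T sg))) +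
      ennreal (q / A) * (\<Sum>i<T. enat_root q (mp_seq per sg (Suc i)))"
    if sg: "finite_until T sg" for sg
  proof -
    let ?b = "mp_block per T sg"
    let ?X = "\<lambda>i. real (the_enat (?b ! i)) powr (1 / q)"
    have card: "real (card (first_occs ?b)) \<ge> 1"
    proof -
      have "0 \<in> first_occs ?b" using T by (simp add: first_occs_def)
      then have "card (first_occs ?b) > 0" by (auto simp: card_gt_0_iff)
      then show ?thesis by linarith
    qed
    have "first_log_sum ?b \<le> (\<Sum>i\<in>first_occs ?b. q * (ln A - 1) + q / A * ?X i)"
      unfolding first_log_sum_def
    proof (rule sum_mono)
      fix i assume "i \<in> first_occs ?b"
      then have "i < T" by (simp add: first_occs_def)
      with sg obtain k where k: "?b ! i = enat k" "k \<ge> 1"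
        unfolding finite_until_def by (rule finite_block)
      define x where "x = ?X i"
      \<comment> \<open>Writing \<open>ln k\<close> as \<open>q\<close> times the logarithm of the
        \<open>q\<close>-th root brings in the quantity whose mean is given.\<close>
      have X: "x > 0" and ln_k: "ln (real (the_enat (?b ! i))) = q * ln x"
        using q k by (simp_all add: x_def ln_powr)
      have "ln (x / A) \<le> x / A - 1"
        using X A by (intro ln_le_minus_one) auto
      then have "ln x \<le> ln A - 1 + x / A"
        using X A by (simp add: ln_div)
      then have "q * ln x \<le> q * (ln A - 1 + x / A)"
        using q by (intro mult_left_mono) auto
      then show "ln (real (the_enat (?b ! i))) \<le> q * (ln A - 1) + q / A * ?X i"
        unfolding ln_k x_def[symmetric] by (simp add: algebra_simps)
    qed
    also have "\<dots> = q * ln A * real (card (first_occs ?b)) - q * real (card (first_occs ?b)) +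
        q / A * (\<Sum>i\<in>first_occs ?b. ?X i)"
      by (simp only: sum.distrib sum_constant sum_distrib_left[symmetric]) (simp add: algebra_simps)
    \<comment> \<open>The sum is extended from first occurrences to all times, where stationarity
      applies; of the negative terms only one is kept, since at least one first occurrence
      exists.\<close>
    also have "\<dots> \<le> q * ln A * real (card (first_occs ?b)) - q + q / A * (\<Sum>i<T. ?X i)"
    proof -
      have "(\<Sum>i\<in>first_occs ?b. ?X i) \<le> (\<Sum>i<T. ?X i)"
        by (intro sum_mono2) (auto simp: first_occs_def)
      then have "q / A * (\<Sum>i\<in>first_occs ?b. ?X i) \<le> q / A * (\<Sum>i<T. ?X i)"
        using q A by (intro mult_left_mono) auto
      moreover have "q \<le> q * real (card (first_occs ?b))" using q card by simp
      ultimately show ?thesis by linarith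
    qed
    finally have "first_log_sum ?b + q \<le> q * ln A * real (card (set ?b)) + q / A * (\<Sum>i<T. ?X i)"
      by (simp add: card_first_occs)
    then have "ennreal (first_log_sum ?b + q) \<le>
        ennreal (q * ln A * real (card (set ?b)) + q / A * (\<Sum>i<T. ?X i))"
      by (rule ennreal_leI)
    also have "\<dots> = ennreal (q * ln A * real (card (set ?b))) + ennreal (q / A * (\<Sum>i<T. ?X i))"
      using q A by (intro ennreal_plus mult_nonneg_nonneg sum_nonneg) auto
    also have "ennreal (q * ln A * real (card (set ?b))) = ennreal (q * ln A) * of_nat (card (set ?b))"
      using q A by (subst ennreal_mult) (auto simp: ennreal_of_nat_eq_real_of_nat)
    also have "ennreal (q / A * (\<Sum>i<T. ?X i)) = ennreal (q / A) * (\<Sum>i<T. ennreal (?X i))"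
      using q A by (subst ennreal_mult) (auto intro: sum_nonneg simp: sum_ennreal)
    also have "(\<Sum>i<T. ennreal (?X i)) = (\<Sum>i<T. enat_root q (mp_seq per sg (Suc i)))"
    proof (rule sum.cong)
      fix i assume "i \<in> {..<T}"
      then have "i < T" by simp
      with sg obtain k where "?b ! i = enat k" unfolding finite_until_def by (rule finite_block)
      with \<open>i < T\<close> show "ennreal (?X i) = enat_root q (mp_seq per sg (Suc i))"
        by (simp add: enat_root_def nth_mp_block)
    qed simp
    finally show ?thesis
      using q first_log_sum_nonneg[of ?b] by simp
  qed
  have "mean_first_log T + ennreal q = (\<integral>\<^sup>+ sg. ennreal (first_log_sum (mp_block per T sg)) + ennreal q \<partial>M)"
    unfolding mean_first_log_def by (simp add: nn_integral_add emeasure_space_1)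
  also have "\<dots> \<le> (\<integral>\<^sup>+ sg. ennreal (q * ln A) * of_nat (card (set (mp_block per T sg))) +
      ennreal (q / A) * (\<Sum>i<T. enat_root q (mp_seq per sg (Suc i))) \<partial>M)"
    using AE_finite_until[of q T] root pw by (intro nn_integral_mono_AE) (auto elim!: eventually_mono)
  also have "\<dots> = ennreal (q * ln A) * mean_card T +
      ennreal (q / A) * (\<Sum>i<T. \<integral>\<^sup>+ sg. enat_root q (mp_seq per sg (Suc i)) \<partial>M)"
  proof -
    have [measurable]: "(\<lambda>sg. enat_root q (mp_seq per sg (Suc i))) \<in> borel_measurable M" for i
      by (rule measurable_compose[OF measurable_mp_seq]) simp
    show ?thesis
      unfolding mean_card_def set_mp_block[symmetric]
      by (simp add: nn_integral_add nn_integral_cmult nn_integral_sum)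
  qed
  also have "(\<Sum>i<T. \<integral>\<^sup>+ sg. enat_root q (mp_seq per sg (Suc i)) \<partial>M) = ennreal A"
    using m by (simp add: stationary root A_def ennreal_mult ennreal_of_nat_eq_real_of_nat)
  also have "ennreal (q / A) * ennreal A = ennreal q"
    using q A by (simp add: ennreal_mult[symmetric])
  finally show ?thesis by (simp add: A_def add.commute[of _ "ennreal q"])
qed

text \<open>With \<open>per 1 \<ge> 2\<close> the first output differs from 1 with probability at
  least 1/2, and then its logarithm is at least \<open>ln 2\<close>.\<close>

lemma ln_2_le_mean_first_log:
  assumes fin: "AE sg in M. finite_until 1 sg" and per1: "per 1 \<noteq> 1"
  shows "ennreal (ln 2) \<le> 2 * mean_first_log 1"
proof -
  let ?E = "{sg \<in> space M. mp_seq per sg 1 = 1}"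
  have "(\<lambda>sg. mp_seq per sg 1) \<in> M \<rightarrow>\<^sub>M count_space UNIV" using measurable_mp_seq[of 0] by simp
  then have E: "?E \<in> sets M" by measurable
  have "1 / real (per 1) \<le> 1 / 2" using per1 per_ge_1[of 1] by (intro divide_left_mono) auto
  then have "1 / 2 \<le> prob (space M - ?E)"
    using prob_compl[OF E] prob_first_output_eq_1 by simp
  then have "ln 2 / 2 \<le> ln 2 * prob (space M - ?E)"
    using mult_left_mono[of "1 / 2" "prob (space M - ?E)" "ln 2"] by simp
  then have "ennreal (ln 2 / 2) \<le> ennreal (ln 2) * emeasure M (space M - ?E)"
    by (simp add: emeasure_eq_measure ennreal_mult[symmetric] ennreal_leI)
  also have "\<dots> = (\<integral>\<^sup>+ sg. ennreal (ln 2) * indicator (space M - ?E) sg \<partial>M)"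
    using E by (simp add: nn_integral_cmult_indicator)
  also have "\<dots> \<le> mean_first_log 1"
    unfolding mean_first_log_def
  proof (rule nn_integral_mono_AE, use fin in eventually_elim)
    case (elim sg)
    then obtain k where "mp_seq per sg 1 = enat k"
      by (auto simp: finite_until_def)
    then have k: "mp_seq per sg 1 = enat k" "k \<ge> 1"
      using mp_seq_ge_1[of per sg 0 k] by simp_all
    moreover have "first_occs [enat k] = {0}" by (auto simp: first_occs_def)
    ultimately have "first_log_sum (mp_block per 1 sg) = ln (real k)"
      by (simp add: first_log_sum_def mp_block_def)
    moreover have "ln 2 \<le> ln (real k)" if "k \<noteq> 1"
      using that k by (subst ln_le_cancel_iff) auto
    ultimately show ?case using k by (auto simp: indicator_def one_enat_def intro: ennreal_leI)
  qed
  finally have "2 * ennreal (ln 2 / 2) \<le> 2 * mean_first_log 1" by (rule mult_left_mono) simp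
  moreover have "2 * ennreal (ln 2 / 2) = ennreal (ln 2)"
    by (subst ennreal_numeral[symmetric], subst ennreal_mult[symmetric]) auto
  ultimately show ?thesis by simp
qed

text \<open>Clock 1 has only the seed 1, so the block of length 1 is deterministic.\<close>

lemma entropy_eq_0:
  assumes "per 1 = 1"
  shows "mp_block_entropy per 1 = 0"
proof -
  have "mp_seq per sg 1 = 1" if "sg \<in> space M" for sg
  proof -
    have "sg 1 \<in> {1..per 1}" using that by (simp only: space_M PiE_iff) auto
    then have "sg 1 = 1" using assms by simp
    then show ?thesis
      using fst_mp_step_eq_enat_iff[of per sg 1] by (simp add: mp_seq_def one_enat_def)
  qed
  then have "{tau \<in> space M. mp_block per 1 tau = mp_block per 1 sg} = space M" if "sg \<in> space M" for sg
    using that by (auto simp: mp_block_def)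
  then have "mp_block_entropy per 1 = (\<integral>\<^sup>+ sg. 0 \<partial>M)"
    unfolding mp_block_entropy_def by (intro nn_integral_cong) (simp add: prob_space)
  then show ?thesis by simp
qed

lemma entropy_bound:
  fixes q m n :: real
  assumes q: "q > 0" and T: "T \<ge> 1" and m: "m \<ge> 1"
    and root: "(\<integral>\<^sup>+ sg. enat_root q (fst (mp_step per sg)) \<partial>M) = ennreal m"
    and n: "mean_card T = ennreal n" "n \<ge> 0"
  shows "mp_block_entropy per T \<le> ennreal ((exp 1 * n + 2) * ((q + 2) * ln (real T) + q * ln m))"
proof -
  have n1: "n \<ge> 1" using mean_card_bounds(1)[OF T] n by simp
  have fin: "AE sg in M. finite_until T sg" using AE_finite_until[of q T] root by simp
  have e2: "exp 1 \<ge> (2 :: real)" using exp_ge_add_one_self[of 1] by simp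
  have lnT: "ln (real T) \<ge> 0" and lnm: "ln m \<ge> 0" using T m by simp_all
  have log: "mean_first_log T \<le> ennreal (q * (ln (real T) + ln m) * n)"
    using mean_first_log_le[OF q T m root] T m n q lnT lnm by (simp add: ln_mult ennreal_mult)
  show ?thesis
  proof (cases "T = 1")
    case True
    have "n = 1" using mean_card_1 n True by simp
    show ?thesis
    proof (cases "per 1 = 1")
      case True
      then show ?thesis using \<open>T = 1\<close> entropy_eq_0 by simp
    next
      case False
      have "mp_block_entropy per T \<le> ennreal (ln 2) + 2 * mean_first_log T"
        using entropy_le_mean_first_log[OF fin T] \<open>T = 1\<close> by (simp add: mean_card_1[simplified])
      \<comment> \<open>The constant \<open>ln 2\<close> is traded for a second copy of the
        logarithmic term. The total factor 4 fits below \<open>exp 1 + 2\<close>.\<close>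
      also have "\<dots> \<le> 2 * mean_first_log T + 2 * mean_first_log T"
        using ln_2_le_mean_first_log False fin \<open>T = 1\<close> by (intro add_right_mono) simp
      also have "\<dots> \<le> 2 * ennreal (q * ln m) + 2 * ennreal (q * ln m)"
        using log \<open>T = 1\<close> \<open>n = 1\<close> by (intro add_mono mult_left_mono) auto
      also have "\<dots> = ennreal (4 * (q * ln m))"
      proof -
        have "2 * ennreal (q * ln m) = ennreal (2 * (q * ln m))"
          by (subst ennreal_mult) (use q lnm in auto)
        then show ?thesis using q lnm by (simp add: ennreal_plus[symmetric] del: ennreal_plus)
      qed
      also have "\<dots> \<le> ennreal ((exp 1 * n + 2) * ((q + 2) * ln (real T) + q * ln m))"
        using q lnm e2 \<open>T = 1\<close> \<open>n = 1\<close> by (intro ennreal_leI) (auto intro!: mult_right_mono)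
      finally show ?thesis .
    qed
  next
    case False
    then have "real T \<ge> 2" using T by simp
    then have ln2: "ln 2 \<le> ln (real T)" by simp
    have half: "ln 2 \<ge> (1 / 2 :: real)" using ln_le_minus_one[of "1 / 2"] by (simp add: ln_div)
    let ?L = "ln (real T)"
    \<comment> \<open>Chosen so that the second factor of the claim equals
      \<open>Q + 2 * ?L\<close>.\<close>
    define Q where "Q = q * (ln (real T) + ln m)"
    have Q: "Q \<ge> 0" using q lnT lnm by (simp add: Q_def)
    have "mp_block_entropy per T \<le> ennreal (?L + ln 2) * ennreal n + 2 * mean_first_log T + 1"
      using entropy_le_mean_first_log[OF fin T] False by (simp add: n)
    also have "\<dots> \<le> ennreal (?L + ln 2) * ennreal n + 2 * ennreal (Q * n) + 1"
      using log by (intro add_mono mult_left_mono) (auto simp: Q_def)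
    also have "\<dots> = ennreal ((?L + ln 2) * n + 2 * (Q * n) + 1)"
    proof -
      have "2 * ennreal (Q * n) = ennreal (2 * (Q * n))"
        using Q n by (simp add: ennreal_mult)
      then show ?thesis using Q n lnT by (simp add: ennreal_mult)
    qed
    also have "\<dots> \<le> ennreal ((exp 1 * n + 2) * ((q + 2) * ?L + q * ln m))"
    proof (rule ennreal_leI)
      \<comment> \<open>As \<open>?L \<ge> ln 2 \<ge> 1 / 2\<close>, the constant 1 is at most
        \<open>4 * ?L\<close>, which the summand 2 in the first factor of the claim pays
        for.\<close>
      have "(?L + ln 2) * n + 2 * (Q * n) + 1 \<le> 2 * ?L * n + 2 * (Q * n) + 4 * ?L"
      proof -
        have "(?L + ln 2) * n \<le> 2 * ?L * n" using ln2 n by (intro mult_right_mono) auto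
        then show ?thesis using ln2 half by linarith
      qed
      also have "\<dots> \<le> (2 * n + 2) * (Q + 2 * ?L)"
        using Q lnT n by (simp add: algebra_simps)
      also have "\<dots> \<le> (exp 1 * n + 2) * (Q + 2 * ?L)"
        using Q lnT n e2 by (intro mult_right_mono add_mono) auto
      finally show "(?L + ln 2) * n + 2 * (Q * n) + 1 \<le> (exp 1 * n + 2) * ((q + 2) * ?L + q * ln m)"
        by (simp add: Q_def algebra_simps)
    qed
    finally show ?thesis .
  qed
qed

end

theorem theorem7:
  fixes per :: "nat \<Rightarrow> nat" and T t :: nat and q :: real
  assumes "\<forall>r\<ge>1. per r \<ge> 1"
    and "T \<ge> 1" and "t \<ge> 1" and "q > 0"
  shows "mp_block_entropy per T
    \<le> ennreal (exp 1 * enn2real (\<integral>\<^sup>+ sg. of_nat (card (mp_seq per sg ` {1..T})) \<partial>mp_measure per) + 2)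
       * (let EK = (\<integral>\<^sup>+ sg. enat_root q (mp_seq per sg t) \<partial>mp_measure per) in
          if EK = \<top> then \<top>
          else ennreal ((q + 2) * ln (real T) + q * ln (enn2real EK)))"
proof -
  interpret multiperiodic per using assms(1) by unfold_locales auto
  obtain i where "t = Suc i" using \<open>t \<ge> 1\<close> by (cases t) auto
  define EK where "EK = (\<integral>\<^sup>+ sg. enat_root q (fst (mp_step per sg)) \<partial>M)"
  have EK: "(\<integral>\<^sup>+ sg. enat_root q (mp_seq per sg t) \<partial>M) = EK"
    unfolding \<open>t = Suc i\<close> EK_def by (rule stationary)
  define n where "n = enn2real (mean_card T)"
  have n_nonneg: "n \<ge> 0" by (simp add: n_def)
  show ?thesis
  proof (cases "EK = \<top>")
    case True
    \<comment> \<open>Since \<open>0 * \<top> = 0\<close> in \<open>ennreal\<close>, the right side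
      is \<top> only because its first factor is positive.\<close>
    then show ?thesis
      unfolding EK mean_card_def[symmetric] n_def[symmetric]
      using n_nonneg by (simp add: ennreal_mult_top add_nonneg_pos)
  next
    case False
    define m where "m = enn2real EK"
    have root: "EK = ennreal m" using False by (simp add: m_def less_top)
    have m: "m \<ge> 1" using mean_root_ge_1[OF \<open>q > 0\<close>] root by (simp add: EK_def)
    \<comment> \<open>Finiteness ensures that \<open>enn2real\<close> does not send the mean to its
      default 0.\<close>
    have "mean_card T < \<top>"
      using mean_card_bounds(2)[OF \<open>T \<ge> 1\<close>] by (rule le_less_trans) (simp add: ennreal_of_nat_eq_real_of_nat)
    then have n: "mean_card T = ennreal n" by (simp add: n_def)
    have "mp_block_entropy per T \<le> ennreal ((exp 1 * n + 2) * ((q + 2) * ln (real T) + q * ln m))"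
      using \<open>q > 0\<close> \<open>T \<ge> 1\<close> m root[unfolded EK_def] n n_nonneg by (rule entropy_bound)
    also have "\<dots> = ennreal (exp 1 * n + 2) * ennreal ((q + 2) * ln (real T) + q * ln m)"
      using n_nonneg \<open>q > 0\<close> \<open>T \<ge> 1\<close> m by (intro ennreal_mult) auto
    finally show ?thesis
      using False unfolding EK mean_card_def[symmetric] n_def[symmetric] Let_def by (simp add: m_def)
  qed
qed

end
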